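(* Let $G$ be a normed gyrogroup with identity $e$. If $f$ is an isometry of $G$ with respect to the gyronorm metric, then $$f=L_{f(e)}\circ\rho,$$ where $\rho$ is an isometry of $G$ (with respect to the gyronorm metric) that leaves the gyrogroup identity fixed, i.e. $\rho(e)=e$.
   Context: A gyrogroup is a nonempty set $G$ with a binary operation $\oplus$ such that: (G1) there is an element $e\in G$ with $e\oplus a=a$ for all $a\in G$; (G2) for each $a\in G$ there is $b\in G$ with $b\oplus a=e$; (G3) for all $a,b\in G$ there is an automorphism $\mathrm{gyr}[a,b]$ of $(G,\oplus)$ (a bijection $G\to G$ preserving $\oplus$) such that $a\oplus(b\oplus c)=(a\oplus b)\oplus\mathrm{gyr}[a,b]c$ for all $c\in G$; (G4) $\mathrm{gyr}[a\oplus b,b]=\mathrm{gyr}[a,b]$ for all $a,b\in G$. Then $e$ is the unique two-sided identity and each $a$ has a unique two-sided inverse $\ominus a$; $\mathrm{gyr}[a,b]$ is called the gyroautomorphism generated by $a$ and $b$. For $a\in G$, the left gyrotranslation $L_a\colon G\to G$ is $L_a(x)=a\oplus x$. A gyronorm on a gyrogroup $G$ is a function $\|\cdot\|\colon G\to\mathbb{R}$ such that: (1) $\|x\|\ge 0$ for all $x\in G$, and $\|x\|=0$ if and only if $x=e$; (2) $\|\ominus x\|=\|x\|$ for all $x\in G$; (3) $\|x\oplus y\|\le\|x\|+\|y\|$ for all $x,y\in G$; (4) $\|\mathrm{gyr}[a,b]x\|=\|x\|$ for all $a,b,x\in G$. A normed gyrogroup is a gyrogroup equipped with a gyronorm; its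 gyronorm metric is $d(x,y)=\|\ominus x\oplus y\|$. An isometry of $G$ is a distance-preserving bijection of $(G,d)$ onto itself. *)

theory Defs
  imports Complex_Main
begin

text \<open>The map \<open>gyr\<close> is a parameter of the locale, but it is determined on \<open>G\<close> by \<open>gyroassoc\<close>
  (left cancellation holds).  Functions are only relevant on the carrier, so the equation
  \<open>gyr[a \<oplus> b, b] = gyr[a, b]\<close> of automorphisms of \<open>G\<close> is stated pointwise on \<open>G\<close>.\<close>

locale gyrogroup =
  fixes G :: "'a set"
    and gadd :: "'a \<Rightarrow> 'a \<Rightarrow> 'a"
    and e :: 'a
    and gyr :: "'a \<Rightarrow> 'a \<Rightarrow> 'a \<Rightarrow> 'a"
  assumes gadd_closed: "\<lbrakk>a \<in> G; b \<in> G\<rbrakk> \<Longrightarrow> gadd a b \<in> G"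
    and e_closed: "e \<in> G"
    and left_id: "a \<in> G \<Longrightarrow> gadd e a = a"
    and left_inv: "a \<in> G \<Longrightarrow> \<exists>b\<in>G. gadd b a = e"
    and gyr_bij: "\<lbrakk>a \<in> G; b \<in> G\<rbrakk> \<Longrightarrow> bij_betw (gyr a b) G G"
    and gyr_hom: "\<lbrakk>a \<in> G; b \<in> G; x \<in> G; y \<in> G\<rbrakk>
      \<Longrightarrow> gyr a b (gadd x y) = gadd (gyr a b x) (gyr a b y)"
    and gyroassoc: "\<lbrakk>a \<in> G; b \<in> G; c \<in> G\<rbrakk>
      \<Longrightarrow> gadd a (gadd b c) = gadd (gadd a b) (gyr a b c)"
    and left_loop: "\<lbrakk>a \<in> G; b \<in> G; c \<in> G\<rbrakk> \<Longrightarrow> gyr (gadd a b) b c = gyr a b c"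

definition gyroinv :: "'a set \<Rightarrow> ('a \<Rightarrow> 'a \<Rightarrow> 'a) \<Rightarrow> 'a \<Rightarrow> 'a \<Rightarrow> 'a" where
  "gyroinv G gadd e a = (THE b. b \<in> G \<and> gadd b a = e \<and> gadd a b = e)"

definition left_gyrotranslation :: "('a \<Rightarrow> 'a \<Rightarrow> 'a) \<Rightarrow> 'a \<Rightarrow> 'a \<Rightarrow> 'a" where
  "left_gyrotranslation gadd a = (\<lambda>x. gadd a x)"

locale normed_gyrogroup = gyrogroup G gadd e gyr
  for G :: "'a set" and gadd e gyr +
  fixes gnorm :: "'a \<Rightarrow> real"
  assumes gnorm_nonneg: "x \<in> G \<Longrightarrow> gnorm x \<ge> 0"
    and gnorm_eq_0_iff: "x \<in> G \<Longrightarrow> gnorm x = 0 \<longleftrightarrow> x = e"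
    and gnorm_inv: "x \<in> G \<Longrightarrow> gnorm (gyroinv G gadd e x) = gnorm x"
    and gnorm_triangle: "\<lbrakk>x \<in> G; y \<in> G\<rbrakk> \<Longrightarrow> gnorm (gadd x y) \<le> gnorm x + gnorm y"
    and gnorm_gyr: "\<lbrakk>a \<in> G; b \<in> G; x \<in> G\<rbrakk> \<Longrightarrow> gnorm (gyr a b x) = gnorm x"

definition gyronorm_metric ::
    "'a set \<Rightarrow> ('a \<Rightarrow> 'a \<Rightarrow> 'a) \<Rightarrow> 'a \<Rightarrow> ('a \<Rightarrow> real) \<Rightarrow> 'a \<Rightarrow> 'a \<Rightarrow> real" where
  "gyronorm_metric G gadd e gnorm x y = gnorm (gadd (gyroinv G gadd e x) y)"

definition isometry_of :: "'a set \<Rightarrow> ('a \<Rightarrow> 'a \<Rightarrow> real) \<Rightarrow> ('a \<Rightarrow> 'a) \<Rightarrow> bool" where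
  "isometry_of M d f \<longleftrightarrow> bij_betw f M M \<and> (\<forall>x\<in>M. \<forall>y\<in>M. d (f x) (f y) = d x y)"

context gyrogroup
begin

lemma gyr_closed: "\<lbrakk>a \<in> G; b \<in> G; c \<in> G\<rbrakk> \<Longrightarrow> gyr a b c \<in> G"
  using gyr_bij bij_betwE by blast

lemma left_cancel:
  assumes "a \<in> G" "b \<in> G" "c \<in> G" "gadd a b = gadd a c"
  shows "b = c"
proof -
  obtain x where x: "x \<in> G" "gadd x a = e" using left_inv assms(1) by blast
  have "gyr x a b = gyr x a c"
    using gyroassoc[OF x(1) assms(1,2)] gyroassoc[OF x(1) assms(1,3)] assms x
    by (simp add: left_id gyr_closed)
  then show ?thesis using gyr_bij[OF x(1) assms(1)] assms(2,3)
    by (meson bij_betw_imp_inj_on inj_onD)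
qed

lemma left_inv_cancel:
  assumes "x \<in> G" "a \<in> G" "gadd x a = e" "b \<in> G"
  shows "gadd x (gadd a b) = b"
proof -
  have "gadd a b = gadd a (gyr e a b)"
    using gyroassoc[OF e_closed assms(2,4)] assms by (simp add: left_id gadd_closed)
  then have "gyr e a b = b"
    using left_cancel assms by (metis gyr_closed e_closed)
  then have "gyr x a b = b" using left_loop[OF assms(1,2,4)] assms(3) by simp
  then show ?thesis using gyroassoc[OF assms(1,2,4)] assms by (simp add: left_id)
qed

text \<open>The description in the definition of \<open>gyroinv\<close> is proper.\<close>

lemma ex1_two_sided_inv:
  assumes "a \<in> G"
  shows "\<exists>!b. b \<in> G \<and> gadd b a = e \<and> gadd a b = e"
proof -
  obtain x where x: "x \<in> G" "gadd x a = e" using left_inv assms by blast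
  have right_id: "gadd y e = y" if y: "y \<in> G" for y
  proof -
    obtain z where z: "z \<in> G" "gadd z y = e" using left_inv y by blast
    have "gadd z (gadd y e) = gadd z y"
      using left_inv_cancel[OF z(1) y z(2) e_closed] z by simp
    then show ?thesis using left_cancel y z by (metis gadd_closed e_closed)
  qed
  have "gadd x (gadd a x) = gadd x e"
    using left_inv_cancel[OF x(1) assms x(2) x(1)] right_id x by simp
  then have "gadd a x = e" using left_cancel x assms by (metis gadd_closed e_closed)
  then show ?thesis using x assms left_cancel by metis
qed

lemma gyroinv_props:
  assumes "a \<in> G"
  shows "gyroinv G gadd e a \<in> G" "gadd (gyroinv G gadd e a) a = e"
    "gadd a (gyroinv G gadd e a) = e"
  using theI'[OF ex1_two_sided_inv[OF assms]] unfolding gyroinv_def by auto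

end

end

theory Submission
  imports Defs
begin

text \<open>Left gyrotranslations are isometries: writing \<open>y = x \<oplus> (\<ominus>x \<oplus> y)\<close>, gyroassociativity gives
  \<open>\<ominus>(a \<oplus> x) \<oplus> (a \<oplus> y) = gyr[a, x] (\<ominus>x \<oplus> y)\<close>, and gyrations preserve the norm. Hence
  \<open>\<rho> = L\<^bsub>\<ominus>f(e)\<^esub> \<circ> f\<close> is an isometry, it fixes \<open>e\<close>, and \<open>f = L\<^bsub>f(e)\<^esub> \<circ> \<rho>\<close> by left
  cancellation.\<close>

lemma isometry_of_comp:
  assumes "isometry_of M d g" "isometry_of M d f"
  shows "isometry_of M d (g \<circ> f)"
  using assms unfolding isometry_of_def by (auto intro: bij_betw_trans dest: bij_betwE)

context gyrogroup
begin

lemma gyroinv_left_cancel: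
  assumes "a \<in> G" "b \<in> G"
  shows "gadd (gyroinv G gadd e a) (gadd a b) = b"
  using left_inv_cancel gyroinv_props[OF assms(1)] assms by blast

text \<open>The inverse is two-sided, so \<open>a\<close> is itself a left inverse of
  \<open>gyroinv G gadd e a\<close>; this is \<open>left_inv_cancel\<close> with the two roles
  exchanged.\<close>

lemma gyroinv_right_cancel:
  assumes "a \<in> G" "b \<in> G"
  shows "gadd a (gadd (gyroinv G gadd e a) b) = b"
  using left_inv_cancel gyroinv_props[OF assms(1)] assms by blast

lemma bij_betw_left_gyrotranslation:
  assumes "a \<in> G"
  shows "bij_betw (left_gyrotranslation gadd a) G G"
  \<comment> \<open>The two cancellation laws make translation by the inverse of \<open>a\<close> a
    two-sided inverse map on \<open>G\<close>.\<close>
  by (rule bij_betw_byWitness[where f' = "left_gyrotranslation gadd (gyroinv G gadd e a)"])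
    (auto simp: left_gyrotranslation_def gyroinv_left_cancel gyroinv_right_cancel
      gadd_closed gyroinv_props assms)

lemma gyroinv_gyrotranslation:
  assumes "a \<in> G" "x \<in> G" "y \<in> G"
  shows "gadd (gyroinv G gadd e (gadd a x)) (gadd a y) = gyr a x (gadd (gyroinv G gadd e x) y)"
proof -
  let ?z = "gadd (gyroinv G gadd e x) y"
  have z: "?z \<in> G" using assms by (simp add: gadd_closed gyroinv_props)
  have "gadd a y = gadd (gadd a x) (gyr a x ?z)"
    using gyroassoc[OF assms(1,2) z] by (simp add: gyroinv_right_cancel assms)
  \<comment> \<open>Cancel \<open>gadd a x\<close> on the left.\<close>
  then show ?thesis
    using assms z by (simp add: gyroinv_left_cancel gadd_closed gyr_closed)
qed

end

lemma (in normed_gyrogroup) isometry_of_left_gyrotranslation: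
  assumes "a \<in> G"
  shows "isometry_of G (gyronorm_metric G gadd e gnorm) (left_gyrotranslation gadd a)"
  using bij_betw_left_gyrotranslation[OF assms] assms
  by (simp add: isometry_of_def gyronorm_metric_def left_gyrotranslation_def
      gyroinv_gyrotranslation gnorm_gyr gadd_closed gyroinv_props)

theorem theorem4p7:
  fixes G :: "'a set"
    and gadd :: "'a \<Rightarrow> 'a \<Rightarrow> 'a"
    and e :: 'a
    and gyr :: "'a \<Rightarrow> 'a \<Rightarrow> 'a \<Rightarrow> 'a"
    and gnorm :: "'a \<Rightarrow> real"
    and f :: "'a \<Rightarrow> 'a"
  assumes "normed_gyrogroup G gadd e gyr gnorm"
    and "isometry_of G (gyronorm_metric G gadd e gnorm) f"
  shows "\<exists>\<rho>. isometry_of G (gyronorm_metric G gadd e gnorm) \<rho> \<and> \<rho> e = e \<and>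
    (\<forall>x\<in>G. f x = (left_gyrotranslation gadd (f e) \<circ> \<rho>) x)"
proof -
  interpret normed_gyrogroup G gadd e gyr gnorm by fact
  \<comment> \<open>Cancellation is available only on the carrier, so the values of \<open>f\<close>
    must lie in \<open>G\<close>; this is also why the factorization is pointwise on
    \<open>G\<close>.\<close>
  have f: "f x \<in> G" if "x \<in> G" for x
    using assms(2) that unfolding isometry_of_def by (blast dest: bij_betwE)
  let ?\<rho> = "left_gyrotranslation gadd (gyroinv G gadd e (f e)) \<circ> f"
  have "isometry_of G (gyronorm_metric G gadd e gnorm) ?\<rho>"
    by (intro isometry_of_comp isometry_of_left_gyrotranslation gyroinv_props f e_closed assms(2))
  moreover have "?\<rho> e = e"
    by (simp add: left_gyrotranslation_def gyroinv_props f e_closed)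
  moreover have "\<forall>x\<in>G. f x = (left_gyrotranslation gadd (f e) \<circ> ?\<rho>) x"
    by (simp add: left_gyrotranslation_def gyroinv_right_cancel f e_closed)
  ultimately show ?thesis by blast
qed

end
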